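(* Let $\theta,\kappa\le\mathfrak c$ be infinite cardinals, with $\kappa$ given the discrete topology. Suppose there exists $\mathcal A\subseteq[\kappa]^\omega$ with $|\mathcal A|\le\theta$ such that for every sequence $(\mathcal C_n:n\in\omega)$ of finite, nonempty, pairwise disjoint subsets of $\kappa$ there exist an infinite $E\subseteq\omega$ and $B\in\mathcal A$ with $\left|B\cap\bigcup_{n\in E}\mathcal C_n\right|<\omega$. Then there exists $X$ with $\kappa\subseteq X\subseteq\beta\kappa$ such that $\operatorname{CL}(X)$ is pseudocompact and $X$ is not $(\theta,\omega^* )$-pseudocompact.
   Context: $\beta\kappa$ is the Stone–Čech compactification of the discrete space $\kappa$ (the space of ultrafilters on $\kappa$). $[\kappa]^\omega$ denotes the countably infinite subsets of $\kappa$. $\omega^*$ is the set of free ultrafilters on $\omega$. For $p\in\omega^*$ and a sequence $(B_n:n\in\omega)$ of subsets of $X$, $x\in X$ is a $p$-limit of $(B_n)$ if $\{n:V\cap B_n\ne\emptyset\}\in p$ for every neighborhood $V$ of $x$. $X$ is $(\theta,\omega^* )$-pseudocompact if for every family $\{(V^\alpha_n:n\in\omega):\alpha<\theta\}$ of sequences of nonempty open subsets of $X$ there is $p\in\omega^*$ such that each $(V^\alpha_n:n\in\omega)$ has a $p$-limit point in $X$. $\operatorname{CL}(X)$ is the set of nonempty closed subsets of $X$ with the Vietoris topology; pseudocompact means every continuous real-valued function is bounded. *)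

theory Defs
  imports "HOL-Analysis.Analysis"
begin

abbreviation card_le :: "'a set \<Rightarrow> 'b set \<Rightarrow> bool" where
  "card_le A B \<equiv> ordLeq3 (card_of A) (card_of B)"

definition ultrafilter_on :: "'a set \<Rightarrow> 'a set set \<Rightarrow> bool" where
  "ultrafilter_on I U \<longleftrightarrow>
     U \<subseteq> Pow I \<and> I \<in> U \<and> {} \<notin> U \<and>
     (\<forall>A\<in>U. \<forall>B\<in>U. A \<inter> B \<in> U) \<and>
     (\<forall>A\<in>U. \<forall>B. A \<subseteq> B \<and> B \<subseteq> I \<longrightarrow> B \<in> U) \<and>
     (\<forall>A. A \<subseteq> I \<longrightarrow> A \<in> U \<or> I - A \<in> U)"

definition free_ultrafilter_nat :: "nat set set \<Rightarrow> bool" where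
  "free_ultrafilter_nat p \<longleftrightarrow> ultrafilter_on UNIV p \<and> (\<forall>A\<in>p. infinite A)"

text \<open>Stone-Cech compactification of the discrete space K: ultrafilters on K with the
  topology generated by the basic clopen sets {u. A \<in> u}, A \<subseteq> K.\<close>
definition beta_space :: "'a set \<Rightarrow> 'a set set set" where
  "beta_space K = {u. ultrafilter_on K u}"

definition beta_top :: "'a set \<Rightarrow> 'a set set topology" where
  "beta_top K = topology_generated_by {{u \<in> beta_space K. A \<in> u} | A. A \<subseteq> K}"

text \<open>The canonical copy of the point k of K inside beta K: the principal ultrafilter.\<close>
definition principal_uf :: "'a set \<Rightarrow> 'a \<Rightarrow> 'a set set" where
  "principal_uf K k = {A. A \<subseteq> K \<and> k \<in> A}"

definition CL :: "'a topology \<Rightarrow> 'a set set" where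
  "CL X = {F. closedin X F \<and> F \<noteq> {}}"

definition vietoris :: "'a topology \<Rightarrow> 'a set topology" where
  "vietoris X = topology_generated_by
     ({{F \<in> CL X. F \<subseteq> U} | U. openin X U} \<union> {{F \<in> CL X. F \<inter> U \<noteq> {}} | U. openin X U})"

definition pseudocompact :: "'a topology \<Rightarrow> bool" where
  "pseudocompact X \<longleftrightarrow>
     (\<forall>f. continuous_map X euclideanreal f \<longrightarrow> bounded (f ` topspace X))"

definition p_limit :: "'a topology \<Rightarrow> nat set set \<Rightarrow> (nat \<Rightarrow> 'a set) \<Rightarrow> 'a \<Rightarrow> bool" where
  "p_limit X p B x \<longleftrightarrow> x \<in> topspace X \<and>
     (\<forall>V. openin X V \<and> x \<in> V \<longrightarrow> {n. V \<inter> B n \<noteq> {}} \<in> p)"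

text \<open>(theta, omega^*)-pseudocompactness, theta given as the cardinality of a set Th.\<close>
definition theta_omega_pseudocompact :: "'b set \<Rightarrow> 'a topology \<Rightarrow> bool" where
  "theta_omega_pseudocompact Th X \<longleftrightarrow>
     (\<forall>V :: 'b \<Rightarrow> nat \<Rightarrow> 'a set.
        (\<forall>\<alpha>\<in>Th. \<forall>n. openin X (V \<alpha> n) \<and> V \<alpha> n \<noteq> {}) \<longrightarrow>
        (\<exists>p. free_ultrafilter_nat p \<and> (\<forall>\<alpha>\<in>Th. \<exists>x. p_limit X p (V \<alpha>) x)))"

end

theory Submission
  imports Defs "HOL-Library.Nat_Bijection"
begin

text \<open>Call the set of Rudin--Keisler predecessors of an ultrafilter its type. Every type has at most
  continuum many elements, whereas there are more ultrafilters than that, so there are more than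
  continuum many types; hence the sequences \<open>C\<close> of pairwise disjoint finite subsets of \<open>K\<close> can be
  assigned free ultrafilters \<open>p\<^sub>C\<close> of distinct types, each containing the set \<open>E\<close> that the hypothesis
  provides for \<open>C\<close>. Let \<open>X\<close> consist of \<open>K\<close> and the \<open>p\<^sub>C\<close>-limits of all selectors of all such \<open>C\<close>.

  An unbounded continuous function on the hyperspace of \<open>X\<close> would be unbounded along a sequence of
  finite subsets of \<open>K\<close>; a subsequence splits into a convergent part and a pairwise disjoint (or
  empty) part, and the limits of its selectors give it an accumulation point in the hyperspace.

  On the other hand, if one \<open>q\<close> gave limits in \<open>X\<close> to enumerations of all members of \<open>\<A>\<close>, all these
  limits would have the type of \<open>q\<close>, hence would come from one single \<open>C\<close>. The member \<open>B\<close> of \<open>\<A>\<close>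
  that is almost disjoint from \<open>\<Union>n\<in>E. C n\<close> contradicts this.\<close>

section \<open>Free ultrafilters on the natural numbers\<close>

context
  fixes p :: "nat set set"
  assumes p: "free_ultrafilter_nat p"
begin

lemma free_uf_Int: "A \<in> p \<Longrightarrow> B \<in> p \<Longrightarrow> A \<inter> B \<in> p"
  using p by (auto simp: free_ultrafilter_nat_def ultrafilter_on_def)

lemma free_uf_mono: "A \<in> p \<Longrightarrow> A \<subseteq> B \<Longrightarrow> B \<in> p"
  using p by (auto simp: free_ultrafilter_nat_def ultrafilter_on_def)

lemma free_uf_infinite: "A \<in> p \<Longrightarrow> infinite A"
  using p by (auto simp: free_ultrafilter_nat_def)

lemma free_uf_UNIV: "UNIV \<in> p"
  using p by (auto simp: free_ultrafilter_nat_def ultrafilter_on_def)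

lemma free_uf_empty: "{} \<notin> p"
  using p by (auto simp: free_ultrafilter_nat_def ultrafilter_on_def)

lemma free_uf_Compl: "A \<in> p \<or> - A \<in> p"
  using p by (auto simp: free_ultrafilter_nat_def ultrafilter_on_def Compl_eq_Diff_UNIV)

lemma free_uf_Compl_iff: "- A \<in> p \<longleftrightarrow> A \<notin> p"
  using free_uf_Int[of A "- A"] free_uf_Compl[of A] free_uf_empty by auto

lemma free_uf_Int_iff: "E \<in> p \<Longrightarrow> A \<inter> E \<in> p \<longleftrightarrow> A \<in> p"
  using free_uf_Int[of A E] free_uf_mono[of "A \<inter> E" A] by blast

lemma free_uf_cofinite:
  assumes "finite (- A)"
  shows "A \<in> p"
  using assms free_uf_Compl[of A] free_uf_infinite by blast

lemma free_uf_Inter: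
  assumes "finite T" "T \<subseteq> p"
  shows "\<Inter> T \<in> p"
  using assms by (induction rule: finite_induct) (auto simp: free_uf_UNIV free_uf_Int)

lemma free_uf_INT:
  assumes "finite I" "\<And>i. i \<in> I \<Longrightarrow> T i \<in> p"
  shows "(\<Inter>i\<in>I. T i) \<in> p"
  using assms by (intro free_uf_Inter) auto

end

text \<open>The strong finite intersection property: intersections are infinite rather than merely
  nonempty, so that maximal families come out free.\<close>

definition infinite_intersections :: "'a set set \<Rightarrow> bool" where
  "infinite_intersections M \<longleftrightarrow> (\<forall>T. finite T \<and> T \<subseteq> M \<longrightarrow> infinite (\<Inter> T))"

text \<open>Maximality enters through \<open>mem\<close> alone: a set with infinite trace on every
  finite intersection can be adjoined, hence already belongs. For complements, two finite
  subfamilies rejecting \<open>A\<close> and \<open>- A\<close> would together have a finite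
  intersection.\<close>

lemma maximal_infinite_intersections_free:
  fixes M :: "nat set set"
  assumes M: "infinite_intersections M"
    and maxM: "\<And>N. infinite_intersections N \<Longrightarrow> M \<subseteq> N \<Longrightarrow> N = M"
  shows "free_ultrafilter_nat M"
proof -
  have mem: "A \<in> M" if "\<And>T. finite T \<Longrightarrow> T \<subseteq> M \<Longrightarrow> infinite (\<Inter> T \<inter> A)" for A
  proof -
    have "infinite_intersections (insert A M)"
      unfolding infinite_intersections_def
    proof (intro allI impI)
      fix T assume T: "finite T \<and> T \<subseteq> insert A M"
      have "infinite (\<Inter> (T - {A}) \<inter> A)"
        using T by (intro that) auto
      moreover have "\<Inter> (T - {A}) \<inter> A \<subseteq> \<Inter> T"
        by auto
      ultimately show "infinite (\<Inter> T)"
        using finite_subset by blast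
    qed
    then show ?thesis
      using maxM by blast
  qed
  have inf: "infinite (\<Inter> T)" if "finite T" "T \<subseteq> M" for T
    using M that by (auto simp: infinite_intersections_def)
  have up: "B \<in> M" if "A \<in> M" "A \<subseteq> B" for A B
  proof (rule mem)
    fix T assume "finite T" "T \<subseteq> M"
    then have "infinite (\<Inter> (insert A T))"
      using that inf by blast
    moreover have "\<Inter> (insert A T) \<subseteq> \<Inter> T \<inter> B"
      using that by auto
    ultimately show "infinite (\<Inter> T \<inter> B)"
      using finite_subset by blast
  qed
  have int: "A \<inter> B \<in> M" if "A \<in> M" "B \<in> M" for A B
  proof (rule mem)
    fix T assume "finite T" "T \<subseteq> M"
    then have "infinite (\<Inter> (insert A (insert B T)))"
      using that by (intro inf) auto
    then show "infinite (\<Inter> T \<inter> (A \<inter> B))"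
      by (simp add: Int_ac)
  qed
  have comp: "A \<in> M \<or> - A \<in> M" for A
  proof (rule ccontr)
    assume "\<not> ?thesis"
    then obtain T1 T2 where T: "finite T1" "T1 \<subseteq> M" "finite (\<Inter> T1 \<inter> A)"
      "finite T2" "T2 \<subseteq> M" "finite (\<Inter> T2 \<inter> - A)"
      using mem by metis
    have "\<Inter> (T1 \<union> T2) \<subseteq> (\<Inter> T1 \<inter> A) \<union> (\<Inter> T2 \<inter> - A)"
      by auto
    then have "finite (\<Inter> (T1 \<union> T2))"
      using T(3,6) finite_subset by blast
    with inf[of "T1 \<union> T2"] T show False
      by auto
  qed
  have free: "infinite A" if "A \<in> M" for A
    using inf[of "{A}"] that by auto
  have "UNIV \<in> M"
    using inf by (intro mem) auto
  moreover have "{} \<notin> M"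
    using free by blast
  ultimately show ?thesis
    using up int comp free
    by (simp add: free_ultrafilter_nat_def ultrafilter_on_def flip: Compl_eq_Diff_UNIV)
qed

text \<open>The property concerns finite subfamilies only, and a finite subset of the union of a
  nonempty chain lies in one member, so Zorn's lemma applies.\<close>

lemma free_ultrafilter_extends:
  fixes \<S> :: "nat set set"
  assumes \<S>: "infinite_intersections \<S>"
  obtains p where "free_ultrafilter_nat p" "\<S> \<subseteq> p"
proof -
  let ?F = "{M. infinite_intersections M \<and> \<S> \<subseteq> M}"
  have "\<exists>M\<in>?F. \<forall>N\<in>?F. M \<subseteq> N \<longrightarrow> N = M"
  proof (rule subset_Zorn_nonempty)
    show "?F \<noteq> {}"
      using \<S> by auto
  next
    fix C assume C: "C \<noteq> {}" "subset.chain ?F C"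
    have "infinite (\<Inter> T)" if T: "finite T" "T \<subseteq> \<Union> C" for T
    proof -
      obtain M where "M \<in> C" "T \<subseteq> M"
        using finite_subset_Union_chain[OF T C] .
      then show ?thesis
        using T(1) C(2) unfolding subset.chain_def infinite_intersections_def by blast
    qed
    then have "infinite_intersections (\<Union> C)"
      by (auto simp: infinite_intersections_def)
    moreover have "\<S> \<subseteq> \<Union> C"
      using C unfolding subset.chain_def by blast
    ultimately show "\<Union> C \<in> ?F"
      by blast
  qed
  then obtain M where M: "infinite_intersections M" "\<S> \<subseteq> M"
    and maxM: "\<And>N. infinite_intersections N \<Longrightarrow> M \<subseteq> N \<Longrightarrow> N = M"
    by auto
  show ?thesis
    using maximal_infinite_intersections_free[OF M(1) maxM] M(2) that by blast
qed

lemma free_ultrafilter_containing: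
  fixes E :: "nat set"
  assumes "infinite E"
  obtains p where "free_ultrafilter_nat p" "E \<in> p"
proof -
  have "infinite_intersections {E}"
    unfolding infinite_intersections_def
  proof (intro allI impI)
    fix T assume "finite T \<and> T \<subseteq> {E}"
    then have "T = {} \<or> T = {E}"
      by auto
    then show "infinite (\<Inter> T)"
      using assms by auto
  qed
  then show ?thesis
    using free_ultrafilter_extends that by (metis insert_subset)
qed

section \<open>Independent sets and the number of ultrafilters\<close>

text \<open>A natural number \<open>i\<close> codes a pair of a finite set \<open>F\<close> and a finite family \<open>S\<close> of finite sets;
  it belongs to the set indexed by \<open>x\<close> when \<open>x \<inter> F \<in> S\<close> (Hausdorff's independent family).\<close>

definition hausdorff_set :: "nat set \<Rightarrow> nat set" where
  "hausdorff_set x = {i. set_encode (x \<inter> set_decode (fst (prod_decode i)))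
                          \<in> set_decode (snd (prod_decode i))}"

text \<open>Finitely many pairs have finitely many least points of difference, and these have a
  common strict bound.\<close>

lemma finite_sets_separated:
  fixes Z :: "nat set set"
  assumes "finite Z"
  obtains m :: nat where "inj_on (\<lambda>x. x \<inter> {..<m}) Z"
proof -
  define d where "d x y = (LEAST i. i \<in> x \<longleftrightarrow> i \<notin> y)" for x y :: "nat set"
  have d: "d x y \<in> x \<longleftrightarrow> d x y \<notin> y" if "x \<noteq> y" for x y
  proof -
    from that obtain i where "i \<in> x \<longleftrightarrow> i \<notin> y"
      by auto
    then show ?thesis
      unfolding d_def by (rule LeastI)
  qed
  \<comment> \<open>\<open>insert 0\<close> makes the maximum meaningful for empty \<open>Z\<close>;
    \<open>Suc\<close> makes the bound strict.\<close>
  define m where "m = Suc (Max (insert 0 ((\<lambda>(x, y). d x y) ` (Z \<times> Z))))"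
  have "d x y < m" if "x \<in> Z" "y \<in> Z" for x y
    using that assms unfolding m_def less_Suc_eq_le by (intro Max_ge) auto
  then have "inj_on (\<lambda>x. x \<inter> {..<m}) Z"
    using d by (intro inj_onI) (metis Int_iff lessThan_iff)
  then show ?thesis
    using that by blast
qed

lemma inj_on_Int_lessThan_mono:
  fixes Z :: "nat set set"
  assumes "inj_on (\<lambda>x. x \<inter> {..<m}) Z" "m \<le> n"
  shows "inj_on (\<lambda>x. x \<inter> {..<n}) Z"
proof (rule inj_onI)
  fix x y assume xy: "x \<in> Z" "y \<in> Z" "x \<inter> {..<n} = y \<inter> {..<n}"
  have "z \<inter> {..<m} = z \<inter> {..<n} \<inter> {..<m}" for z
    using assms(2) by auto
  then have "x \<inter> {..<m} = y \<inter> {..<m}"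
    by (metis xy(3))
  with xy assms show "x = y"
    by (auto dest: inj_onD)
qed

text \<open>Once \<open>n\<close> is large enough for initial segments to tell the members of
  \<open>P \<union> N\<close> apart, the code of \<open>{..<n}\<close> together with the traces of
  \<open>P\<close> on it lies in the required sets. Different \<open>n\<close> give different
  codes.\<close>

lemma hausdorff_sets_independent:
  assumes fin: "finite P" "finite N" and disj: "P \<inter> N = {}"
  shows "infinite ((\<Inter>x\<in>P. hausdorff_set x) \<inter> (\<Inter>x\<in>N. - hausdorff_set x))"
proof -
  obtain m where m: "inj_on (\<lambda>x. x \<inter> {..<m}) (P \<union> N)"
    using finite_sets_separated[of "P \<union> N"] fin by auto
  define c where "c n = prod_encode (set_encode {..<n},
    set_encode ((\<lambda>x. set_encode (x \<inter> {..<n})) ` P))" for n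
  have "c n \<in> hausdorff_set x \<longleftrightarrow> x \<in> P" if "m \<le> n" "x \<in> P \<union> N" for n x
  proof -
    have "c n \<in> hausdorff_set x
        \<longleftrightarrow> set_encode (x \<inter> {..<n}) \<in> (\<lambda>x. set_encode (x \<inter> {..<n})) ` P"
      using fin by (simp add: hausdorff_set_def c_def)
    also have "\<dots> \<longleftrightarrow> x \<inter> {..<n} \<in> (\<lambda>x. x \<inter> {..<n}) ` P"
      by (simp add: image_iff set_encode_eq)
    also have "\<dots> \<longleftrightarrow> x \<in> P"
      using inj_on_image_mem_iff[OF inj_on_Int_lessThan_mono[OF m that(1)] that(2)] by simp
    finally show ?thesis .
  qed
  then have sub: "c ` {m..} \<subseteq> (\<Inter>x\<in>P. hausdorff_set x) \<inter> (\<Inter>x\<in>N. - hausdorff_set x)"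
    using disj by auto
  have "inj c"
    by (auto intro!: injI simp: c_def set_encode_eq lessThan_eq_iff)
  then have "infinite (c ` {m..})"
    using finite_imageD[OF _ inj_on_subset[OF _ subset_UNIV], of c "{m..}"] infinite_Ici by blast
  with sub show ?thesis
    using finite_subset by blast
qed

text \<open>Independence allows \<open>Y\<close> to be prescribed as exactly the index set of the
  Hausdorff sets in \<open>w Y\<close>, so \<open>w Y\<close> determines \<open>Y\<close>. The
  domain has more than continuum many elements, which the counting of types relies on.\<close>

lemma many_free_ultrafilters:
  obtains w :: "nat set set \<Rightarrow> nat set set"
    where "inj w" "\<And>Y. free_ultrafilter_nat (w Y)"
proof -
  have "\<exists>p. free_ultrafilter_nat p \<and> (\<forall>x. hausdorff_set x \<in> p \<longleftrightarrow> x \<in> Y)" for Y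
  proof -
    let ?S = "hausdorff_set ` Y \<union> (\<lambda>x. - hausdorff_set x) ` (- Y)"
    have "infinite_intersections ?S"
      unfolding infinite_intersections_def
    proof (intro allI impI)
      fix T assume T: "finite T \<and> T \<subseteq> ?S"
      define A where "A = T \<inter> hausdorff_set ` Y"
      define B where "B = T - hausdorff_set ` Y"
      have "finite A" "finite B" "A \<subseteq> hausdorff_set ` Y" "B \<subseteq> (\<lambda>x. - hausdorff_set x) ` (- Y)"
        and TAB: "T = A \<union> B"
        using T by (auto simp: A_def B_def)
      then obtain P N where "P \<subseteq> Y" "finite P" "A = hausdorff_set ` P"
        "N \<subseteq> - Y" "finite N" "B = (\<lambda>x. - hausdorff_set x) ` N"
        by (metis finite_subset_image)
      moreover have "P \<inter> N = {}"
        using calculation by auto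
      ultimately have "infinite (\<Inter> A \<inter> \<Inter> B)"
        using hausdorff_sets_independent by metis
      then show "infinite (\<Inter> T)"
        by (simp add: TAB Inter_Un_distrib)
    qed
    then obtain p where "free_ultrafilter_nat p" "?S \<subseteq> p"
      using free_ultrafilter_extends by blast
    then show ?thesis
      using free_uf_Compl_iff by (metis (no_types, lifting) ComplI UnCI image_eqI subsetD)
  qed
  then obtain w where w: "\<And>Y. free_ultrafilter_nat (w Y)"
    "\<And>Y x. hausdorff_set x \<in> w Y \<longleftrightarrow> x \<in> Y"
    by metis
  then have "inj w"
    by (metis injI subsetI subset_antisym)
  with w(1) that show ?thesis
    by blast
qed

section \<open>Images of ultrafilters\<close>

text \<open>The pushforward of \<open>p\<close>. When \<open>f\<close> maps into \<open>K\<close>,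
  it is the \<open>p\<close>-limit in \<open>beta_space K\<close> of the principal ultrafilters at
  the points \<open>f n\<close>.\<close>

definition uf_image :: "'a set \<Rightarrow> (nat \<Rightarrow> 'a) \<Rightarrow> nat set set \<Rightarrow> 'a set set" where
  "uf_image K f p = {S. S \<subseteq> K \<and> f -` S \<in> p}"

lemma uf_image_in_beta:
  assumes p: "free_ultrafilter_nat p" and f: "range f \<subseteq> K"
  shows "uf_image K f p \<in> beta_space K"
proof -
  have "f -` K = UNIV"
    using f by auto
  moreover have "f -` (K - A) = - (f -` A)" for A
    using f by auto
  ultimately show ?thesis
    using free_uf_Int[OF p] free_uf_UNIV[OF p] free_uf_empty[OF p] free_uf_Compl_iff[OF p]
    unfolding beta_space_def ultrafilter_on_def uf_image_def
    by (auto simp: vimage_Int intro: free_uf_mono[OF p, OF _ vimage_mono])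
qed

lemma uf_image_comp: "uf_image UNIV g (uf_image UNIV f p) = uf_image UNIV (g \<circ> f) p"
  by (auto simp: uf_image_def vimage_comp)

lemma uf_image_id: "uf_image UNIV id p = p"
  by (simp add: uf_image_def)

lemma uf_image_free:
  assumes p: "free_ultrafilter_nat p" and "inj f"
  shows "free_ultrafilter_nat (uf_image UNIV f p)"
proof -
  have "uf_image UNIV f p \<in> beta_space UNIV"
    using p by (intro uf_image_in_beta) auto
  moreover have "infinite S" if "f -` S \<in> p" for S
    using free_uf_infinite[OF p that] finite_vimageI[OF _ \<open>inj f\<close>] by blast
  ultimately show ?thesis
    by (auto simp: free_ultrafilter_nat_def beta_space_def uf_image_def)
qed

section \<open>Rudin-Keisler types\<close>

definition rk_below :: "nat set set \<Rightarrow> nat set set set" where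
  "rk_below p = range (\<lambda>f. uf_image UNIV f p)"

lemma rk_below_refl: "p \<in> rk_below p"
  unfolding rk_below_def using uf_image_id by (metis rangeI)

lemma rk_below_mono: "rk_below (uf_image UNIV f p) \<subseteq> rk_below p"
  unfolding rk_below_def uf_image_comp by auto

text \<open>Injectivity of \<open>f\<close> lets the sets in \<open>q\<close> be read off from the
  common image, whence \<open>q\<close> is the image of \<open>p\<close> under
  \<open>inv f \<circ> g\<close>. Outside the preimage of \<open>range f\<close> under
  \<open>g\<close> this map is arbitrary, but that preimage belongs to \<open>p\<close>.\<close>

lemma rk_below_subset:
  assumes p: "free_ultrafilter_nat p" and q: "free_ultrafilter_nat q"
    and f: "inj f" "range f \<subseteq> K" and eq: "uf_image K f q = uf_image K g p"
  shows "rk_below q \<subseteq> rk_below p"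
proof -
  have trans: "N \<in> q \<longleftrightarrow> g -` (f ` N) \<in> p" for N
  proof -
    have "N \<in> q \<longleftrightarrow> f ` N \<in> uf_image K f q"
      using f by (auto simp: uf_image_def inj_vimage_image_eq)
    also have "\<dots> \<longleftrightarrow> g -` (f ` N) \<in> p"
      unfolding eq using f(2) by (auto simp: uf_image_def)
    finally show ?thesis .
  qed
  have range: "g -` range f \<in> p"
    using trans[of UNIV] free_uf_UNIV[OF q] by simp
  have "N \<in> q \<longleftrightarrow> (inv f \<circ> g) -` N \<in> p" for N
  proof -
    have "g -` (f ` N) = (inv f \<circ> g) -` N \<inter> g -` range f"
      using f(1) by (auto intro!: image_eqI)
    then show ?thesis
      using trans free_uf_Int_iff[OF p range] by simp
  qed
  then have "q = uf_image UNIV (inv f \<circ> g) p"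
    by (auto simp: uf_image_def)
  then show ?thesis
    using rk_below_mono by metis
qed

text \<open>Injective sequences with the same limit, along possibly different ultrafilters, reveal a
  common type; this later compares \<open>q\<close> with the ultrafilters that define
  \<open>X\<close>.\<close>

lemma rk_below_eqI:
  assumes "free_ultrafilter_nat p" "free_ultrafilter_nat q"
    and "inj f" "range f \<subseteq> K" "inj g" "range g \<subseteq> K" "uf_image K f q = uf_image K g p"
  shows "rk_below q = rk_below p"
  using assms by (intro antisym rk_below_subset[of _ _ f K g] rk_below_subset[of _ _ g K f]) simp_all

text \<open>Pushing \<open>q\<close> along the increasing enumeration of \<open>E\<close> brings
  \<open>E\<close> into the ultrafilter; injectivity keeps the type.\<close>

lemma rk_below_representative:
  assumes q: "free_ultrafilter_nat q" and E: "infinite E"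
  obtains p where "free_ultrafilter_nat p" "E \<in> p" "rk_below p = rk_below q"
proof -
  let ?p = "uf_image UNIV (enumerate E) q"
  have inj: "inj (enumerate E)"
    using strict_mono_enumerate[OF E] by (rule strict_mono_imp_inj_on)
  have "enumerate E -` E = UNIV"
    using enumerate_in_set[OF E] by auto
  then have "E \<in> ?p"
    using free_uf_UNIV[OF q] by (simp add: uf_image_def)
  moreover have free: "free_ultrafilter_nat ?p"
    using q inj by (rule uf_image_free)
  moreover have "uf_image UNIV id ?p = uf_image UNIV (enumerate E) q"
    by (simp add: uf_image_id)
  then have "rk_below ?p = rk_below q"
    using q free inj by (intro rk_below_eqI[of q ?p id UNIV "enumerate E"]) auto
  ultimately show ?thesis
    using that by blast
qed

text \<open>If the types of the \<open>w Y\<close> embedded in \<open>\<G>\<close>, then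
  \<open>w Y\<close> would be determined by the member of \<open>\<G>\<close> attached to its type
  and a function producing it from a representative. Through \<open>c\<close> this would embed sets
  of sets of naturals into sets of naturals, against Cantor. Comparability of cardinals then gives
  an embedding in the other direction.\<close>

lemma inj_into_rk_types:
  fixes \<G> :: "'g set" and c :: "'g \<times> (nat \<Rightarrow> nat) \<Rightarrow> nat set"
  assumes c: "inj_on c (\<G> \<times> UNIV)"
  obtains j where "inj_on j \<G>" "\<forall>G\<in>\<G>. \<exists>q. free_ultrafilter_nat q \<and> j G = rk_below q"
proof -
  obtain w :: "nat set set \<Rightarrow> nat set set" where w: "inj w" "\<And>Y. free_ultrafilter_nat (w Y)"
    using many_free_ultrafilters by blast
  let ?R = "range (\<lambda>Y. rk_below (w Y))"
  have "\<not> (\<exists>r. inj_on r ?R \<and> r ` ?R \<subseteq> \<G>)"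
  proof
    assume "\<exists>r. inj_on r ?R \<and> r ` ?R \<subseteq> \<G>"
    then obtain r where r: "inj_on r ?R" "r ` ?R \<subseteq> \<G>"
      by blast
    \<comment> \<open>The representative depends on the type alone, so equal types and equal
      functions yield equal ultrafilters.\<close>
    define rep where "rep R = w (SOME Y. rk_below (w Y) = R)" for R
    have rep: "rk_below (rep (rk_below (w Y))) = rk_below (w Y)" for Y
      unfolding rep_def by (rule someI) simp
    have "\<exists>f. w Y = uf_image UNIV f (rep (rk_below (w Y)))" for Y
    proof -
      have "w Y \<in> rk_below (rep (rk_below (w Y)))"
        unfolding rep by (rule rk_below_refl)
      then show ?thesis
        by (subst (asm) rk_below_def) blast
    qed
    then obtain f where f: "\<And>Y. w Y = uf_image UNIV (f Y) (rep (rk_below (w Y)))"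
      by metis
    have "inj (\<lambda>Y. c (r (rk_below (w Y)), f Y))"
    proof (rule injI)
      fix Y Z assume "c (r (rk_below (w Y)), f Y) = c (r (rk_below (w Z)), f Z)"
      then have "r (rk_below (w Y)) = r (rk_below (w Z))" "f Y = f Z"
        using inj_onD[OF c, of "(r (rk_below (w Y)), f Y)" "(r (rk_below (w Z)), f Z)"] r(2)
        by (simp_all add: image_subset_iff)
      then have "rk_below (w Y) = rk_below (w Z)"
        by (intro inj_onD[OF r(1)]) auto
      then have "w Y = w Z"
        using f[of Y] f[of Z] \<open>f Y = f Z\<close> by simp
      then show "Y = Z"
        by (rule injD[OF w(1)])
    qed
    then have "surj (inv (\<lambda>Y. c (r (rk_below (w Y)), f Y)))"
      by (rule inj_imp_surj_inv)
    then show False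
      using Cantors_theorem[of "UNIV :: nat set set"] unfolding Pow_UNIV by (rule notE[OF _ exI, rotated])
  qed
  then have "\<not> card_le ?R \<G>"
    by (simp add: card_of_ordLeq[symmetric])
  then have "card_le \<G> ?R"
    using ordLeq_total[OF card_of_Well_order card_of_Well_order] by blast
  then obtain j where "inj_on j \<G>" "j ` \<G> \<subseteq> ?R"
    by (auto simp: card_of_ordLeq[symmetric])
  then show ?thesis
    using w(2) by (intro that) blast+
qed

text \<open>Points of \<open>K\<close> are viewed as sets of naturals. The code of
  \<open>(C, f)\<close> lists, for all \<open>n\<close> and \<open>m\<close>, the value
  \<open>f n\<close> and the traces on \<open>{..<m}\<close> of the members of \<open>C n\<close>;
  all \<open>m\<close> occur because the precision that separates two finite sets depends on
  them.\<close>

lemma finite_sequences_code: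
  fixes K :: "'a set"
  assumes "card_le K (UNIV :: real set)"
  obtains c :: "(nat \<Rightarrow> 'a set) \<times> (nat \<Rightarrow> nat) \<Rightarrow> nat set"
    where "inj_on c ({C. \<forall>n. finite (C n) \<and> C n \<subseteq> K} \<times> UNIV)"
proof -
  obtain i0 :: "'a \<Rightarrow> real" where i0: "inj_on i0 K"
    using assms by (auto simp: card_of_ordLeq[symmetric])
  obtain j :: "real \<Rightarrow> nat set" where j: "inj j"
    using nat_sets_eqpoll_reals by (auto simp: eqpoll_def bij_betw_def dest: inj_on_the_inv_into)
  define i where "i = j \<circ> i0"
  have i: "inj_on i K"
    unfolding i_def using i0 inj_on_subset[OF j] by (intro comp_inj_on) auto
  define tr where "tr m x = set_encode (i x \<inter> {..<m})" for m :: nat and x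
  define c :: "(nat \<Rightarrow> 'a set) \<times> (nat \<Rightarrow> nat) \<Rightarrow> nat set" where
    "c = (\<lambda>(C, f). range (\<lambda>(n, m). prod_encode (prod_encode (n, m),
                              prod_encode (set_encode (tr m ` C n), f n))))"
  have "inj_on c ({C. \<forall>n. finite (C n) \<and> C n \<subseteq> K} \<times> UNIV)"
  proof (rule inj_onI, clarify)
    fix C D :: "nat \<Rightarrow> 'a set" and f g :: "nat \<Rightarrow> nat"
    assume C: "\<forall>n. finite (C n) \<and> C n \<subseteq> K" and D: "\<forall>n. finite (D n) \<and> D n \<subseteq> K"
      and eq: "c (C, f) = c (D, g)"
    have *: "set_encode (tr m ` C n) = set_encode (tr m ` D n) \<and> f n = g n" for n m
    proof -
      have "prod_encode (prod_encode (n, m), prod_encode (set_encode (tr m ` C n), f n)) \<in> c (C, f)"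
        unfolding c_def by (auto intro!: image_eqI[where x = "(n, m)"])
      then have "prod_encode (prod_encode (n, m), prod_encode (set_encode (tr m ` C n), f n)) \<in> c (D, g)"
        by (simp only: eq)
      then show ?thesis
        by (auto simp: c_def)
    qed
    have "C n = D n" for n
    proof -
      have sub: "C n \<union> D n \<subseteq> K" and fin: "finite (i ` (C n \<union> D n))"
        using C D by auto
      obtain m where m: "inj_on (\<lambda>x. x \<inter> {..<m}) (i ` (C n \<union> D n))"
        using finite_sets_separated[OF fin] .
      have "inj_on (tr m) (C n \<union> D n)"
      proof (rule inj_onI)
        fix x y assume xy: "x \<in> C n \<union> D n" "y \<in> C n \<union> D n" and "tr m x = tr m y"
        then have "i x \<inter> {..<m} = i y \<inter> {..<m}"
          by (simp add: tr_def set_encode_eq)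
        then have "i x = i y"
          using imageI[OF xy(1)] imageI[OF xy(2)] by (rule inj_onD[OF m])
        then show "x = y"
          using subsetD[OF sub xy(1)] subsetD[OF sub xy(2)] by (rule inj_onD[OF i])
      qed
      moreover have "tr m ` C n = tr m ` D n"
        using *[of m n] C D by (simp add: set_encode_eq)
      ultimately show ?thesis
        using inj_on_image_eq_iff[of "tr m" "C n \<union> D n" "C n" "D n"] by simp
    qed
    with * show "C = D \<and> f = g"
      by auto
  qed
  then show ?thesis
    using that by blast
qed

section \<open>Subspaces of the Stone--Cech compactification\<close>

lemma topspace_beta_top [simp]: "topspace (beta_top K) = beta_space K"
  by (auto simp: beta_top_def beta_space_def ultrafilter_on_def)

lemma openin_beta_basic: "S \<subseteq> K \<Longrightarrow> openin (beta_top K) {u \<in> beta_space K. S \<in> u}"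
  unfolding beta_top_def by (rule topology_generated_by_Basis) auto

context
  fixes K :: "'a set" and u :: "'a set set"
  assumes u: "u \<in> beta_space K"
begin

lemma beta_subset: "S \<in> u \<Longrightarrow> S \<subseteq> K"
  using u by (simp add: beta_space_def ultrafilter_on_def) (elim conjE, drule (1) subsetD, simp)

lemma beta_empty: "{} \<notin> u"
  using u by (simp add: beta_space_def ultrafilter_on_def)

lemma beta_Int: "A \<in> u \<Longrightarrow> B \<in> u \<Longrightarrow> A \<inter> B \<in> u"
  using u by (simp add: beta_space_def ultrafilter_on_def)

lemma beta_mono: "A \<in> u \<Longrightarrow> A \<subseteq> B \<Longrightarrow> B \<subseteq> K \<Longrightarrow> B \<in> u"
  using u by (simp add: beta_space_def ultrafilter_on_def)

lemma beta_Compl: "A \<subseteq> K \<Longrightarrow> A \<in> u \<or> K - A \<in> u"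
  using u by (simp add: beta_space_def ultrafilter_on_def)

end

lemma principal_in_beta: "k \<in> K \<Longrightarrow> principal_uf K k \<in> beta_space K"
  by (auto simp: principal_uf_def beta_space_def ultrafilter_on_def)

text \<open>\<open>S1 \<inter> S2\<close> lies in an ultrafilter exactly when both sets do, so the
  generating sets are closed under binary intersection and form a base.\<close>

lemma beta_basic_neighbourhood:
  assumes "openin (beta_top K) U" "u \<in> U"
  shows "\<exists>S\<in>u. S \<subseteq> K \<and> {v \<in> beta_space K. S \<in> v} \<subseteq> U"
proof -
  have "generate_topology_on {{u \<in> beta_space K. A \<in> u} | A. A \<subseteq> K} U"
    using assms(1) by (simp add: beta_top_def openin_topology_generated_by_iff)
  moreover have u: "u \<in> beta_space K"
    using openin_subset[OF assms(1)] assms(2) by auto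
  ultimately show ?thesis
    using assms(2)
  proof induction
    case (Int a b)
    then obtain S1 S2 where S: "S1 \<in> u" "S1 \<subseteq> K" "{v \<in> beta_space K. S1 \<in> v} \<subseteq> a"
      "S2 \<in> u" "S2 \<subseteq> K" "{v \<in> beta_space K. S2 \<in> v} \<subseteq> b"
      by auto
    have "S1 \<inter> S2 \<in> u"
      using S by (intro beta_Int[OF u])
    moreover have "S1 \<in> v \<and> S2 \<in> v" if "v \<in> beta_space K" "S1 \<inter> S2 \<in> v" for v
      using that S(2,5) by (simp add: beta_space_def ultrafilter_on_def)
    ultimately show ?case
      using S by (intro bexI[where x = "S1 \<inter> S2"]) auto
  next
    case (UN k)
    then obtain a where a: "a \<in> k" "u \<in> a"
      by auto
    then obtain S where "S \<in> u" "S \<subseteq> K" "{v \<in> beta_space K. S \<in> v} \<subseteq> a"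
      using UN.IH[OF a(1) UN.prems(1) a(2)] by auto
    then show ?case
      using a by (intro bexI[where x = S]) auto
  qed auto
qed

lemma beta_maximal:
  assumes u: "u \<in> beta_space K" and v: "v \<in> beta_space K" and "u \<subseteq> v"
  shows "u = v"
proof
  show "v \<subseteq> u"
  proof
    fix S assume S: "S \<in> v"
    then have "S \<subseteq> K"
      by (rule beta_subset[OF v])
    have "K - S \<notin> v"
    proof
      assume "K - S \<in> v"
      with S have "S \<inter> (K - S) \<in> v"
        by (rule beta_Int[OF v])
      then show False
        using beta_empty[OF v] by simp
    qed
    with \<open>u \<subseteq> v\<close> have "K - S \<notin> u"
      by blast
    with beta_Compl[OF u \<open>S \<subseteq> K\<close>] show "S \<in> u"
      by blast
  qed
qed (rule assms)

lemma beta_singleton: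
  assumes u: "u \<in> beta_space K" and k: "{k} \<in> u"
  shows "u = principal_uf K k"
proof -
  have "k \<in> K"
    using beta_subset[OF u k] by simp
  then have "principal_uf K k = u"
    using beta_mono[OF u k]
    by (intro beta_maximal[OF _ u] principal_in_beta) (auto simp: principal_uf_def)
  then show ?thesis
    by simp
qed

text \<open>One point is split off at a time: either the rest of the set is in \<open>u\<close>, or
  the singleton split off is.\<close>

lemma beta_finite:
  assumes u: "u \<in> beta_space K" and "finite F" "F \<in> u"
  shows "u \<in> principal_uf K ` F"
  using assms(2,3)
proof (induction F rule: finite_induct)
  case empty
  then show ?case
    using beta_empty[OF u] by simp
next
  case (insert k F)
  have sub: "insert k F \<subseteq> K"
    using insert.prems by (rule beta_subset[OF u])
  show ?case
  proof (cases "F \<in> u")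
    case True
    then show ?thesis
      using insert.IH by simp
  next
    case False
    then have "K - F \<in> u"
      using beta_Compl[OF u, of F] sub by simp
    with insert.prems have "insert k F \<inter> (K - F) \<in> u"
      by (rule beta_Int[OF u])
    moreover have "insert k F \<inter> (K - F) = {k}"
      using sub insert.hyps by auto
    ultimately have "{k} \<in> u"
      by simp
    then show ?thesis
      using beta_singleton[OF u] by simp
  qed
qed

locale beta_subspace =
  fixes K :: "'a set" and X :: "'a set set set"
  assumes principal_sub: "principal_uf K ` K \<subseteq> X" and sub_beta: "X \<subseteq> beta_space K"
begin

abbreviation pr :: "'a \<Rightarrow> 'a set set" where "pr \<equiv> principal_uf K"

definition T :: "'a set set topology" where "T = subtopology (beta_top K) X"

lemma topspace_T [simp]: "topspace T = X"
  using sub_beta by (auto simp: T_def)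

lemma openin_T_basic:
  assumes "S \<subseteq> K"
  shows "openin T {u \<in> X. S \<in> u}"
proof -
  have "{u \<in> X. S \<in> u} = X \<inter> {u \<in> beta_space K. S \<in> u}"
    using sub_beta by auto
  then show ?thesis
    unfolding T_def using openin_subtopology_Int2[OF openin_beta_basic[OF assms]] by simp
qed

lemma T_basic_neighbourhood:
  assumes "openin T U" "u \<in> U"
  obtains S where "S \<in> u" "S \<subseteq> K" "{v \<in> X. S \<in> v} \<subseteq> U"
proof -
  obtain W where W: "openin (beta_top K) W" "U = W \<inter> X"
    using assms(1) by (auto simp: T_def openin_subtopology)
  then obtain S where "S \<in> u" "S \<subseteq> K" "{v \<in> beta_space K. S \<in> v} \<subseteq> W"
    using beta_basic_neighbourhood[of K W u] assms(2) by auto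
  then show ?thesis
    using W sub_beta that[of S] by auto
qed

lemma principal_dense:
  assumes "openin T U" "U \<noteq> {}"
  obtains k where "k \<in> K" "pr k \<in> U"
proof -
  obtain u where u: "u \<in> U"
    using assms by auto
  obtain S where S: "S \<in> u" "S \<subseteq> K" "{v \<in> X. S \<in> v} \<subseteq> U"
    using T_basic_neighbourhood[OF assms(1) u] .
  have "u \<in> X"
    using u openin_subset[OF assms(1)] by auto
  then have "S \<noteq> {}"
    using S(1) sub_beta beta_empty by blast
  then obtain k where "k \<in> S"
    by auto
  then show ?thesis
    using S that[of k] principal_sub by (auto simp: principal_uf_def)
qed

text \<open>A member of \<open>beta_space K\<close> containing the finite set \<open>F\<close> is
  principal at a point of \<open>F\<close>, so the complement is the basic open set given by
  \<open>K - F\<close>.\<close>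

lemma finite_in_CL:
  assumes "finite F" "F \<noteq> {}" "F \<subseteq> K"
  shows "pr ` F \<in> CL T"
proof -
  have "X - pr ` F = {u \<in> X. K - F \<in> u}"
  proof (intro set_eqI iffI)
    fix u assume u: "u \<in> X - pr ` F"
    then have beta: "u \<in> beta_space K"
      using sub_beta by auto
    have "F \<notin> u"
      using beta_finite[OF beta assms(1)] u by auto
    then show "u \<in> {u \<in> X. K - F \<in> u}"
      using u beta_Compl[OF beta assms(3)] by simp
  qed (auto simp: principal_uf_def)
  then have "openin T (X - pr ` F)"
    using openin_T_basic[of "K - F"] by simp
  then show ?thesis
    using assms principal_sub by (auto simp: CL_def closedin_def)
qed

lemma openin_principal:
  assumes "k \<in> K"
  shows "openin T {pr k}"
proof -
  have "{u \<in> X. {k} \<in> u} = {pr k}"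
  proof (intro equalityI subsetI)
    fix u assume "u \<in> {u \<in> X. {k} \<in> u}"
    then show "u \<in> {pr k}"
      using beta_singleton[of u K k] sub_beta by auto
  qed (use assms principal_sub in \<open>auto simp: principal_uf_def\<close>)
  then show ?thesis
    using openin_T_basic[of "{k}"] assms by simp
qed

text \<open>Every \<open>S \<in> x\<close> gives a neighbourhood of \<open>x\<close>, so
  \<open>p\<close>-many \<open>b n\<close> lie in \<open>S\<close>. This is one inclusion between
  ultrafilters, and maximality turns it into equality.\<close>

lemma p_limit_principal:
  assumes p: "free_ultrafilter_nat p" and b: "range b \<subseteq> K"
    and lim: "p_limit T p (\<lambda>n. {pr (b n)}) x"
  shows "x = uf_image K b p"
proof (rule beta_maximal)
  show x: "x \<in> beta_space K"
    using lim sub_beta by (auto simp: p_limit_def)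
  show "uf_image K b p \<in> beta_space K"
    using p b by (rule uf_image_in_beta)
  show "x \<subseteq> uf_image K b p"
  proof
    fix S assume S: "S \<in> x"
    then have SK: "S \<subseteq> K"
      by (rule beta_subset[OF x])
    let ?V = "{u \<in> X. S \<in> u}"
    have "openin T ?V" "x \<in> ?V"
      using SK S lim by (auto simp: openin_T_basic p_limit_def)
    then have "{n. ?V \<inter> {pr (b n)} \<noteq> {}} \<in> p"
      using lim by (simp only: p_limit_def)
    moreover have "{n. ?V \<inter> {pr (b n)} \<noteq> {}} \<subseteq> b -` S"
      by (auto simp: principal_uf_def)
    ultimately have "b -` S \<in> p"
      by (rule free_uf_mono[OF p])
    with SK show "S \<in> uf_image K b p"
      by (simp add: uf_image_def)
  qed
qed

section \<open>The Vietoris hyperspace\<close>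

lemma CL_subset: "L \<in> CL T \<Longrightarrow> L \<subseteq> X"
  using closedin_subset[of T L] by (simp add: CL_def)

lemma topspace_vietoris [simp]: "topspace (vietoris T) = CL T"
proof -
  have "CL T = {F \<in> CL T. F \<subseteq> X}"
    using CL_subset by auto
  moreover have "openin T X"
    using openin_topspace[of T] by simp
  ultimately have "CL T \<in> {{F \<in> CL T. F \<subseteq> U} | U. openin T U}"
    by blast
  then show ?thesis
    unfolding vietoris_def topology_generated_by_topspace
    by (intro antisym Union_upper Union_least UnI1) auto
qed

text \<open>Finitely many containment conditions merge into one open \<open>U\<close>, whereas
  hitting conditions accumulate in \<open>\<V>\<close>.\<close>

lemma vietoris_neighbourhood:
  assumes "openin (vietoris T) N" "L \<in> N"
  obtains U \<V> where "openin T U" "L \<subseteq> U" "finite \<V>" "\<forall>V\<in>\<V>. openin T V \<and> L \<inter> V \<noteq> {}"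
    "{H \<in> CL T. H \<subseteq> U \<and> (\<forall>V\<in>\<V>. H \<inter> V \<noteq> {})} \<subseteq> N"
proof -
  have L: "L \<subseteq> X"
    using openin_subset[OF assms(1)] assms(2) by (intro CL_subset) auto
  have X: "openin T X"
    using openin_topspace[of T] by simp
  \<comment> \<open>\<open>R\<close> packages the conclusion for variable \<open>N\<close>, so that
    the induction over the generated topology can pass its witnesses on.\<close>
  define R where "R N U \<V> \<longleftrightarrow> openin T U \<and> L \<subseteq> U \<and> finite \<V> \<and>
    (\<forall>V\<in>\<V>. openin T V \<and> L \<inter> V \<noteq> {}) \<and> {H \<in> CL T. H \<subseteq> U \<and> (\<forall>V\<in>\<V>. H \<inter> V \<noteq> {})} \<subseteq> N"
    for N U \<V>
  have "generate_topology_on ({{F \<in> CL T. F \<subseteq> U} | U. openin T U} \<union>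
          {{F \<in> CL T. F \<inter> U \<noteq> {}} | U. openin T U}) N"
    using assms(1) by (simp add: vietoris_def openin_topology_generated_by_iff)
  then have "\<exists>U \<V>. R N U \<V>"
    using assms(2)
  proof induction
    case (Int a b)
    then obtain U1 \<V>1 U2 \<V>2 where 1: "R a U1 \<V>1" and 2: "R b U2 \<V>2"
      by blast
    have "R (a \<inter> b) (U1 \<inter> U2) (\<V>1 \<union> \<V>2)"
      unfolding R_def
    proof (intro conjI)
      show "openin T (U1 \<inter> U2)" "L \<subseteq> U1 \<inter> U2" "finite (\<V>1 \<union> \<V>2)"
        "\<forall>V\<in>\<V>1 \<union> \<V>2. openin T V \<and> L \<inter> V \<noteq> {}"
        using 1 2 by (auto simp: R_def)
      show "{H \<in> CL T. H \<subseteq> U1 \<inter> U2 \<and> (\<forall>V\<in>\<V>1 \<union> \<V>2. H \<inter> V \<noteq> {})} \<subseteq> a \<inter> b"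
      proof
        fix H assume "H \<in> {H \<in> CL T. H \<subseteq> U1 \<inter> U2 \<and> (\<forall>V\<in>\<V>1 \<union> \<V>2. H \<inter> V \<noteq> {})}"
        then have "H \<in> {H \<in> CL T. H \<subseteq> U1 \<and> (\<forall>V\<in>\<V>1. H \<inter> V \<noteq> {})}"
          "H \<in> {H \<in> CL T. H \<subseteq> U2 \<and> (\<forall>V\<in>\<V>2. H \<inter> V \<noteq> {})}"
          by simp_all
        moreover have "{H \<in> CL T. H \<subseteq> U1 \<and> (\<forall>V\<in>\<V>1. H \<inter> V \<noteq> {})} \<subseteq> a"
          "{H \<in> CL T. H \<subseteq> U2 \<and> (\<forall>V\<in>\<V>2. H \<inter> V \<noteq> {})} \<subseteq> b"
          using 1 2 by (simp_all add: R_def)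
        ultimately show "H \<in> a \<inter> b"
          by (intro IntI) (erule (1) subsetD[rotated])+
      qed
    qed
    then show ?case
      by blast
  next
    case (UN k)
    then obtain a U \<V> where "a \<in> k" "R a U \<V>"
      by blast
    then have "R (\<Union> k) U \<V>"
      by (auto simp: R_def)
    then show ?case
      by blast
  next
    case (Basis s)
    then consider U where "openin T U" "s = {F \<in> CL T. F \<subseteq> U}"
      | U where "openin T U" "s = {F \<in> CL T. F \<inter> U \<noteq> {}}"
      by blast
    then show ?case
    proof cases
      case 1
      then have "R s U {}"
        using Basis.prems by (simp add: R_def)
      then show ?thesis
        by blast
    next
      case 2
      \<comment> \<open>A hitting condition puts no bound on the closed set, so the outer set is the
        whole space.\<close>
      then have "R s X {U}"
        using Basis.prems X L by (auto simp: R_def)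
      then show ?thesis
        by blast
    qed
  qed simp
  then obtain U \<V> where "R N U \<V>"
    by blast
  then show ?thesis
    using that[of U \<V>] by (simp add: R_def)
qed

lemma finite_dense_in_vietoris:
  assumes "openin (vietoris T) N" "N \<noteq> {}"
  obtains F where "finite F" "F \<noteq> {}" "F \<subseteq> K" "pr ` F \<in> N"
proof -
  obtain L where L: "L \<in> N"
    using assms by auto
  obtain U \<V> where U: "openin T U" "L \<subseteq> U" and \<V>: "finite \<V>" "\<forall>V\<in>\<V>. openin T V \<and> L \<inter> V \<noteq> {}"
    and sub: "{H \<in> CL T. H \<subseteq> U \<and> (\<forall>V\<in>\<V>. H \<inter> V \<noteq> {})} \<subseteq> N"
    by (rule vietoris_neighbourhood[OF assms(1) L])
  have "L \<in> CL T"
    using openin_subset[OF assms(1)] L by auto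
  then have "L \<noteq> {}"
    by (simp add: CL_def)
  \<comment> \<open>\<open>U\<close> itself is inserted so that a point is chosen even when
    \<open>\<V>\<close> is empty.\<close>
  have "\<exists>k\<in>K. pr k \<in> U \<inter> V" if "V \<in> insert U \<V>" for V
  proof -
    have "openin T (U \<inter> V)" "U \<inter> V \<noteq> {}"
      using that U \<V> \<open>L \<noteq> {}\<close> by (auto intro: openin_Int)
    then show ?thesis
      using principal_dense by metis
  qed
  then obtain k where k: "\<And>V. V \<in> insert U \<V> \<Longrightarrow> k V \<in> K \<and> pr (k V) \<in> U \<inter> V"
    by metis
  let ?F = "k ` insert U \<V>"
  have F: "finite ?F" "?F \<noteq> {}" "?F \<subseteq> K"
    using \<V>(1) k by auto
  moreover have "pr ` ?F \<in> N"
    using finite_in_CL[OF F] k by (intro subsetD[OF sub]) auto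
  ultimately show ?thesis
    using that by blast
qed

text \<open>The limit is the closure of \<open>A\<close> together with the \<open>p\<close>-limits of all selectors of the sequence
  \<open>G n - A\<close>; there are none if this sequence is empty.\<close>

lemma vietoris_p_limit:
  assumes p: "free_ultrafilter_nat p"
    and G: "\<And>n. finite (G n) \<and> G n \<noteq> {} \<and> G n \<subseteq> K"
    and A: "A \<subseteq> K" "\<And>x. x \<in> A \<Longrightarrow> {n. x \<in> G n} \<in> p"
    and cases: "(\<forall>n. G n \<subseteq> A) \<or> (\<forall>n. \<not> G n \<subseteq> A)"
    and lim: "\<And>f. (\<And>n. f n \<in> G n - A) \<Longrightarrow> uf_image K f p \<in> X"
  obtains L where "L \<in> CL T"
    "\<forall>N. openin (vietoris T) N \<and> L \<in> N \<longrightarrow> {n. pr ` G n \<in> N} \<in> p"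
proof -
  define W where "W = {uf_image K f p | f. \<forall>n. f n \<in> G n - A}"
  define L where "L = T closure_of (pr ` A \<union> W)"
  have sub: "pr ` A \<union> W \<subseteq> X"
    using A(1) lim principal_sub by (auto simp: W_def)
  then have sub_L: "pr ` A \<union> W \<subseteq> L"
    unfolding L_def by (intro closure_of_subset) simp
  have "pr ` A \<union> W \<noteq> {}"
  proof (cases "\<forall>n. G n \<subseteq> A")
    case True
    then show ?thesis
      using G by blast
  next
    case False
    then have "\<forall>n. \<exists>x. x \<in> G n - A"
      using cases by blast
    then obtain f where "\<And>n. f n \<in> G n - A"
      by metis
    then have "uf_image K f p \<in> W"
      by (auto simp: W_def)
    then show ?thesis
      by auto
  qed
  with sub_L have L_CL: "L \<in> CL T"
    by (auto simp: CL_def L_def)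
  \<comment> \<open>If \<open>G n\<close> left \<open>U\<close> for \<open>p\<close>-many
    \<open>n\<close>, a selector through points outside \<open>U\<close> would have its limit in
    \<open>W\<close>, hence in the open set \<open>U\<close>, and so would be back in
    \<open>U\<close> at some such \<open>n\<close>.\<close>
  have inside: "{n. pr ` G n \<subseteq> U} \<in> p" if U: "openin T U" "L \<subseteq> U" for U
  proof (rule ccontr)
    define P where "P = - {n. pr ` G n \<subseteq> U}"
    assume "{n. pr ` G n \<subseteq> U} \<notin> p"
    then have P: "P \<in> p"
      using free_uf_Compl_iff[OF p] by (simp add: P_def)
    have *: "\<exists>x\<in>G n - A. pr x \<notin> U" if "n \<in> P" for n
      using that sub_L U(2) by (auto simp: P_def)
    moreover obtain n where "n \<in> P"
      using P free_uf_empty[OF p] by (metis all_not_in_conv)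
    ultimately have "\<forall>n. \<not> G n \<subseteq> A"
      using cases by blast
    \<comment> \<open>The selector must be defined for every \<open>n\<close>. Outside
      \<open>P\<close> any point of \<open>G n - A\<close> serves; one exists because
      \<open>cases\<close> excludes mixed behaviour.\<close>
    then have "\<exists>x. x \<in> G n - A \<and> (n \<in> P \<longrightarrow> pr x \<notin> U)" for n
      using * by (cases "n \<in> P") blast+
    then obtain f where f: "\<And>n. f n \<in> G n - A" "\<And>n. n \<in> P \<Longrightarrow> pr (f n) \<notin> U"
      by metis
    have "uf_image K f p \<in> W"
      using f(1) by (auto simp: W_def)
    then have "uf_image K f p \<in> U"
      using sub_L U(2) by blast
    then obtain S where S: "S \<in> uf_image K f p" "S \<subseteq> K" "{v \<in> X. S \<in> v} \<subseteq> U"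
      by (rule T_basic_neighbourhood[OF U(1)])
    then have "f -` S \<inter> P \<in> p"
      using P free_uf_Int[OF p] by (simp add: uf_image_def)
    then have "f -` S \<inter> P \<noteq> {}"
      using free_uf_empty[OF p] by metis
    then obtain n where n: "f n \<in> S" "n \<in> P"
      by blast
    then have "pr (f n) \<in> {v \<in> X. S \<in> v}"
      using S(2) principal_sub by (auto simp: principal_uf_def)
    with f(2) n S(3) show False
      by blast
  qed
  have hits: "{n. pr ` G n \<inter> V \<noteq> {}} \<in> p" if V: "openin T V" "L \<inter> V \<noteq> {}" for V
  proof -
    \<comment> \<open>An open set meeting the closure meets the set itself, so only points coming
      from \<open>A\<close> and limits of selectors have to be examined.\<close>
    have "V \<inter> (pr ` A \<union> W) \<noteq> {}"
      using V openin_Int_closure_of_eq_empty[OF V(1)] by (simp only: L_def Int_commute) simp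
    then obtain u where u: "u \<in> pr ` A \<union> W" "u \<in> V"
      by blast
    from u(1) consider x where "x \<in> A" "u = pr x"
      | f where "\<And>n. f n \<in> G n - A" "u = uf_image K f p"
      unfolding W_def by blast
    then show ?thesis
    proof cases
      case 1
      show ?thesis
        using u(2) 1 by (intro free_uf_mono[OF p A(2)[OF 1(1)]]) auto
    next
      case 2
      obtain S where S: "S \<in> u" "S \<subseteq> K" "{v \<in> X. S \<in> v} \<subseteq> V"
        using T_basic_neighbourhood[OF V(1) u(2)] .
      then have "f -` S \<in> p"
        by (simp add: 2(2) uf_image_def)
      moreover have "pr (f n) \<in> pr ` G n \<inter> V" if "f n \<in> S" for n
        using that 2(1)[of n] S principal_sub by (auto simp: principal_uf_def)
      then have "f -` S \<subseteq> {n. pr ` G n \<inter> V \<noteq> {}}"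
        by blast
      ultimately show ?thesis
        by (rule free_uf_mono[OF p])
    qed
  qed
  have "{n. pr ` G n \<in> N} \<in> p" if N: "openin (vietoris T) N" "L \<in> N" for N
  proof -
    obtain U \<V> where U: "openin T U" "L \<subseteq> U" and \<V>: "finite \<V>" "\<forall>V\<in>\<V>. openin T V \<and> L \<inter> V \<noteq> {}"
      and sub: "{H \<in> CL T. H \<subseteq> U \<and> (\<forall>V\<in>\<V>. H \<inter> V \<noteq> {})} \<subseteq> N"
      by (rule vietoris_neighbourhood[OF N])
    have "{n. pr ` G n \<subseteq> U} \<inter> (\<Inter>V\<in>\<V>. {n. pr ` G n \<inter> V \<noteq> {}}) \<in> p"
      using inside[OF U] hits \<V> by (intro free_uf_Int[OF p] free_uf_INT[OF p]) auto
    moreover have "{n. pr ` G n \<subseteq> U} \<inter> (\<Inter>V\<in>\<V>. {n. pr ` G n \<inter> V \<noteq> {}}) \<subseteq> {n. pr ` G n \<in> N}"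
    proof
      fix n assume "n \<in> {n. pr ` G n \<subseteq> U} \<inter> (\<Inter>V\<in>\<V>. {n. pr ` G n \<inter> V \<noteq> {}})"
      then have "pr ` G n \<in> {H \<in> CL T. H \<subseteq> U \<and> (\<forall>V\<in>\<V>. H \<inter> V \<noteq> {})}"
        using finite_in_CL G by simp
      with sub show "n \<in> {n. pr ` G n \<in> N}"
        by blast
    qed
    ultimately show ?thesis
      by (rule free_uf_mono[OF p])
  qed
  then have "\<forall>N. openin (vietoris T) N \<and> L \<in> N \<longrightarrow> {n. pr ` G n \<in> N} \<in> p"
    by simp
  with L_CL show ?thesis
    by (rule that)
qed

end

section \<open>Subsequences of finite sets and pseudocompactness of the hyperspace\<close>

text \<open>\<open>B\<close> is the limit of the sequence along a free ultrafilter. Each chosen term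
  agrees with \<open>B\<close> on all points seen before, so a visited point of \<open>B\<close>
  stays in all later terms and a visited point outside \<open>B\<close> never returns.\<close>

lemma split_subsequence:
  fixes F :: "nat \<Rightarrow> 'a set"
  assumes fin: "\<And>n. finite (F n)"
  obtains s :: "nat \<Rightarrow> nat" and A where "strict_mono s" "A \<subseteq> (\<Union>n. F n)"
    "\<forall>x\<in>A. finite {n. x \<notin> F (s n)}"
    "\<forall>m n. m \<noteq> n \<longrightarrow> (F (s m) - A) \<inter> (F (s n) - A) = {}"
    "(\<forall>n. F (s n) \<subseteq> A) \<or> (\<forall>n. \<not> F (s n) \<subseteq> A)"
proof -
  obtain r :: "nat set set" where r: "free_ultrafilter_nat r"
    using free_ultrafilter_containing[OF infinite_UNIV_nat] by blast
  define B where "B = {x. {n. x \<in> F n} \<in> r}"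
  \<comment> \<open>\<open>Q n\<close> says that \<open>F n\<close> behaves towards \<open>B\<close>
    as \<open>r\<close>-most terms do; it yields the final dichotomy.\<close>
  define Q where "Q n \<longleftrightarrow> (F n \<subseteq> B \<longleftrightarrow> {n. F n \<subseteq> B} \<in> r)" for n
  define P where "P n k \<longleftrightarrow> n < k \<and> (\<forall>x\<in>\<Union>j\<le>n. F j. x \<in> F k \<longleftrightarrow> x \<in> B)" for n k
  have Qr: "{n. Q n} \<in> r"
  proof (cases "{n. F n \<subseteq> B} \<in> r")
    case False
    then have "- {n. F n \<subseteq> B} \<in> r"
      by (simp add: free_uf_Compl_iff[OF r])
    with False show ?thesis
      by (simp add: Q_def Compl_eq)
  qed (simp add: Q_def)
  have ex: "\<exists>k. P n k \<and> Q k" for n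
  proof -
    have "{k. x \<in> F k \<longleftrightarrow> x \<in> B} \<in> r" for x
    proof (cases "x \<in> B")
      case False
      then have "- {k. x \<in> F k} \<in> r"
        by (simp add: free_uf_Compl_iff[OF r] B_def)
      with False show ?thesis
        by (simp add: Compl_eq)
    qed (simp add: B_def)
    then have "(\<Inter>x\<in>\<Union>j\<le>n. F j. {k. x \<in> F k \<longleftrightarrow> x \<in> B}) \<in> r"
      using fin by (intro free_uf_INT[OF r]) auto
    moreover have "{n<..} \<in> r"
      by (rule free_uf_cofinite[OF r]) (simp add: Compl_greaterThan)
    ultimately have "(\<Inter>x\<in>\<Union>j\<le>n. F j. {k. x \<in> F k \<longleftrightarrow> x \<in> B}) \<inter> ({n<..} \<inter> {k. Q k}) \<in> r"
      using Qr by (intro free_uf_Int[OF r])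
    moreover have "(\<Inter>x\<in>\<Union>j\<le>n. F j. {k. x \<in> F k \<longleftrightarrow> x \<in> B}) \<inter> ({n<..} \<inter> {k. Q k})
        \<subseteq> {k. P n k \<and> Q k}"
      by (auto simp: P_def)
    ultimately have "{k. P n k \<and> Q k} \<in> r"
      by (rule free_uf_mono[OF r])
    then have "{k. P n k \<and> Q k} \<noteq> {}"
      using free_uf_empty[OF r] by metis
    then show ?thesis
      by blast
  qed
  have "\<exists>s. \<forall>n. Q (s n) \<and> P (s n) (s (Suc n))"
    by (rule dependent_nat_choice) (use ex in blast)+
  then obtain s where s: "\<And>n. Q (s n)" "\<And>n. P (s n) (s (Suc n))"
    by blast
  have mono: "strict_mono s"
    using s(2) by (simp add: strict_mono_Suc_iff P_def)
  have later: "x \<in> F (s n) \<longleftrightarrow> x \<in> B" if "m < n" "x \<in> F (s m)" for m n x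
  proof -
    obtain k where k: "n = Suc k"
      using \<open>m < n\<close> by (cases n) auto
    then have "s m \<le> s k"
      using \<open>m < n\<close> mono by (simp add: strict_mono_less_eq)
    then show ?thesis
      using s(2)[of k] that(2) by (auto simp: P_def k)
  qed
  \<comment> \<open>Points of \<open>B\<close> that the subsequence never visits are missing from
    every term, so they are cut off.\<close>
  let ?A = "B \<inter> (\<Union>n. F (s n))"
  show ?thesis
  proof (rule that[of s ?A])
    show "\<forall>x\<in>?A. finite {n. x \<notin> F (s n)}"
    proof
      fix x assume x: "x \<in> ?A"
      then obtain m where "x \<in> F (s m)"
        by auto
      then have "{n. x \<notin> F (s n)} \<subseteq> {..m}"
        using x later[of m] by (auto simp flip: not_less)
      then show "finite {n. x \<notin> F (s n)}"
        using finite_subset by blast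
    qed
    show "\<forall>m n. m \<noteq> n \<longrightarrow> (F (s m) - ?A) \<inter> (F (s n) - ?A) = {}"
    proof (intro allI impI)
      fix m n :: nat assume "m \<noteq> n"
      then show "(F (s m) - ?A) \<inter> (F (s n) - ?A) = {}"
        using later[of m n] later[of n m] by (cases "m < n") auto
    qed
    have "F (s n) \<subseteq> ?A \<longleftrightarrow> F (s n) \<subseteq> B" for n
      by auto
    then show "(\<forall>n. F (s n) \<subseteq> ?A) \<or> (\<forall>n. \<not> F (s n) \<subseteq> ?A)"
      using s(1) by (simp add: Q_def)
  qed (use mono in auto)
qed

definition disjoint_finite_seq :: "'a set \<Rightarrow> (nat \<Rightarrow> 'a set) \<Rightarrow> bool" where
  "disjoint_finite_seq K C \<longleftrightarrow> (\<forall>n. finite (C n) \<and> C n \<noteq> {} \<and> C n \<subseteq> K) \<and>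
     (\<forall>m n. m \<noteq> n \<longrightarrow> C m \<inter> C n = {})"

lemma (in beta_subspace) pseudocompact_vietorisI:
  assumes sel: "\<And>C. disjoint_finite_seq K C \<Longrightarrow>
    \<exists>p. free_ultrafilter_nat p \<and> (\<forall>f. (\<forall>n. f n \<in> C n) \<longrightarrow> uf_image K f p \<in> X)"
  shows "pseudocompact (vietoris T)"
  unfolding pseudocompact_def
proof (intro allI impI, rule ccontr)
  fix g assume g: "continuous_map (vietoris T) euclideanreal g"
    and unbounded: "\<not> bounded (g ` topspace (vietoris T))"
  have pre: "openin (vietoris T) {L \<in> CL T. g L \<in> Y}" if "open Y" for Y
    using openin_continuous_map_preimage[OF g, of Y] that by simp
  have "\<exists>F. finite F \<and> F \<noteq> {} \<and> F \<subseteq> K \<and> \<bar>g (pr ` F)\<bar> > real n" for n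
  proof -
    let ?N = "{L \<in> CL T. g L \<in> {y. \<bar>y\<bar> > real n}}"
    have op: "open {y. \<bar>y\<bar> > real n}"
      by (intro open_Collect_less continuous_intros)
    have ne: "?N \<noteq> {}"
      using unbounded by (auto simp: bounded_iff not_le)
    obtain F where "finite F" "F \<noteq> {}" "F \<subseteq> K" "pr ` F \<in> ?N"
      by (rule finite_dense_in_vietoris[OF pre[OF op] ne])
    then show ?thesis
      by auto
  qed
  then obtain F where F: "\<And>n. finite (F n) \<and> F n \<noteq> {} \<and> F n \<subseteq> K" and big: "\<And>n. \<bar>g (pr ` F n)\<bar> > real n"
    by metis
  have finF: "finite (F n)" for n
    using F by blast
  obtain s :: "nat \<Rightarrow> nat" and A where s: "strict_mono s" and A: "A \<subseteq> (\<Union>n. F n)"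
    and fin: "\<forall>x\<in>A. finite {n. x \<notin> F (s n)}"
    and disj: "\<forall>m n. m \<noteq> n \<longrightarrow> (F (s m) - A) \<inter> (F (s n) - A) = {}"
    and cases: "(\<forall>n. F (s n) \<subseteq> A) \<or> (\<forall>n. \<not> F (s n) \<subseteq> A)"
    by (rule split_subsequence[of F, OF finF])
  \<comment> \<open>When nothing remains outside \<open>A\<close> there are no selectors, and any
    free ultrafilter works; otherwise \<open>sel\<close> applies to the disjoint remainders.\<close>
  have "\<exists>p. free_ultrafilter_nat p \<and> (\<forall>f. (\<forall>n. f n \<in> F (s n) - A) \<longrightarrow> uf_image K f p \<in> X)"
  proof (cases "\<forall>n. F (s n) \<subseteq> A")
    case True
    then have "\<not> (\<forall>n. f n \<in> F (s n) - A)" for f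
      by blast
    moreover obtain p :: "nat set set" where "free_ultrafilter_nat p"
      by (rule free_ultrafilter_containing[OF infinite_UNIV_nat])
    ultimately show ?thesis
      by blast
  next
    case False
    then have "disjoint_finite_seq K (\<lambda>n. F (s n) - A)"
      using cases F disj by (auto simp: disjoint_finite_seq_def)
    then show ?thesis
      by (rule sel)
  qed
  then obtain p where p: "free_ultrafilter_nat p"
    and lim: "\<And>f. (\<And>n. f n \<in> F (s n) - A) \<Longrightarrow> uf_image K f p \<in> X"
    by blast
  have A_p: "{n. x \<in> F (s n)} \<in> p" if "x \<in> A" for x
    using fin that by (intro free_uf_cofinite[OF p]) (simp add: Compl_eq)
  have "A \<subseteq> K"
    using A F by blast
  then obtain L where L: "L \<in> CL T"
    "\<forall>N. openin (vietoris T) N \<and> L \<in> N \<longrightarrow> {n. pr ` F (s n) \<in> N} \<in> p"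
    by (rule vietoris_p_limit[of p "\<lambda>n. F (s n)" A, OF p F _ A_p cases lim])
  \<comment> \<open>Near \<open>L\<close> the function is bounded, and \<open>p\<close>-many, hence
    infinitely many, terms lie there, although \<open>n \<le> s n\<close> forces the values to
    grow.\<close>
  let ?N = "{H \<in> CL T. g H \<in> {y. \<bar>y\<bar> < \<bar>g L\<bar> + 1}}"
  have "open {y. \<bar>y\<bar> < \<bar>g L\<bar> + 1}"
    by (intro open_Collect_less continuous_intros)
  then have "openin (vietoris T) ?N"
    by (rule pre)
  moreover have "L \<in> ?N"
    using L(1) by simp
  ultimately have "{n. pr ` F (s n) \<in> ?N} \<in> p"
    by (intro L(2)[rule_format] conjI)
  then have inf: "infinite {n. pr ` F (s n) \<in> ?N}"
    by (rule free_uf_infinite[OF p])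
  obtain m :: nat where m: "\<bar>g L\<bar> + 1 \<le> real m"
    using real_arch_simple by blast
  obtain n where "n \<ge> m" "n \<in> {n. pr ` F (s n) \<in> ?N}"
    using inf unfolding infinite_nat_iff_unbounded_le by blast
  then have n: "n \<ge> m" "\<bar>g (pr ` F (s n))\<bar> < \<bar>g L\<bar> + 1"
    by simp_all
  have "n \<le> s n"
    using s by (rule strict_mono_imp_increasing)
  then have "real m \<le> real (s n)"
    using n(1) by simp
  with n(2) m big[of "s n"] show False
    by linarith
qed

section \<open>Construction of the space and the argument with types\<close>

lemma disjoint_finite_seq_selector:
  assumes "disjoint_finite_seq K C" "\<And>n. f n \<in> C n"
  shows "inj f" "range f \<subseteq> K"
proof -
  show "inj f"
  proof (rule injI, rule ccontr)
    fix m n assume "f m = f n" and mn: "m \<noteq> n"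
    then have "f m \<in> C m \<inter> C n"
      using assms(2)[of m] assms(2)[of n] by simp
    moreover have "C m \<inter> C n = {}"
      using assms(1) mn by (simp add: disjoint_finite_seq_def)
    ultimately show False
      by simp
  qed
  show "range f \<subseteq> K"
    using assms unfolding disjoint_finite_seq_def by blast
qed

lemma infinite_disjoint_finite_seq:
  assumes "infinite K"
  obtains C where "disjoint_finite_seq K C"
proof -
  obtain k :: "nat \<Rightarrow> 'a" where "inj k" "range k \<subseteq> K"
    using infinite_countable_subset[OF assms] by blast
  then have "disjoint_finite_seq K (\<lambda>n. {k n})"
    by (auto simp: disjoint_finite_seq_def dest: injD)
  then show ?thesis
    by (rule that)
qed

theorem theorem4p5:
  fixes K :: "'a set" and Th :: "'b set" and \<A> :: "'a set set"
  assumes K_inf: "infinite K" and K_le_c: "card_le K (UNIV :: real set)"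
    and Th_inf: "infinite Th" and Th_le_c: "card_le Th (UNIV :: real set)"
    and A_sub: "\<A> \<subseteq> {B. B \<subseteq> K \<and> infinite B \<and> countable B}"
    and A_card: "card_le \<A> Th"
    and A_prop: "\<And>C :: nat \<Rightarrow> 'a set.
        (\<forall>n. finite (C n) \<and> C n \<noteq> {} \<and> C n \<subseteq> K) \<Longrightarrow>
        (\<forall>m n. m \<noteq> n \<longrightarrow> C m \<inter> C n = {}) \<Longrightarrow>
        \<exists>E B. infinite E \<and> B \<in> \<A> \<and> finite (B \<inter> (\<Union>n\<in>E. C n))"
  shows "\<exists>X. principal_uf K ` K \<subseteq> X \<and> X \<subseteq> beta_space K \<and>
             pseudocompact (vietoris (subtopology (beta_top K) X)) \<and>
             \<not> theta_omega_pseudocompact Th (subtopology (beta_top K) X)"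
proof -
  define \<G> where "\<G> = {C. disjoint_finite_seq K C}"
  obtain c :: "(nat \<Rightarrow> 'a set) \<times> (nat \<Rightarrow> nat) \<Rightarrow> nat set"
    where "inj_on c ({C. \<forall>n. finite (C n) \<and> C n \<subseteq> K} \<times> UNIV)"
    by (rule finite_sequences_code[OF K_le_c])
  then have c: "inj_on c (\<G> \<times> UNIV)"
    by (rule inj_on_subset) (auto simp: \<G>_def disjoint_finite_seq_def)
  obtain j where j: "inj_on j \<G>" "\<forall>C\<in>\<G>. \<exists>q. free_ultrafilter_nat q \<and> j C = rk_below q"
    by (rule inj_into_rk_types[OF c])
  \<comment> \<open>The ultrafilter of the assigned type \<open>j C\<close> is chosen after
    \<open>E\<close>, so that it can be made to contain \<open>E\<close>.\<close>
  have "\<exists>p E B. free_ultrafilter_nat p \<and> rk_below p = j C \<and> E \<in> p \<and> B \<in> \<A> \<and>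
      finite (B \<inter> (\<Union>n\<in>E. C n))" if "C \<in> \<G>" for C
  proof -
    have "\<exists>E B. infinite E \<and> B \<in> \<A> \<and> finite (B \<inter> (\<Union>n\<in>E. C n))"
      using that by (intro A_prop) (simp_all add: \<G>_def disjoint_finite_seq_def)
    then obtain E B where E: "infinite E" and B: "B \<in> \<A>" "finite (B \<inter> (\<Union>n\<in>E. C n))"
      by blast
    obtain q where q: "free_ultrafilter_nat q" "j C = rk_below q"
      using bspec[OF j(2) \<open>C \<in> \<G>\<close>] by blast
    obtain p where "free_ultrafilter_nat p" "E \<in> p" "rk_below p = rk_below q"
      by (rule rk_below_representative[OF q(1) E])
    with B q(2) have "free_ultrafilter_nat p \<and> rk_below p = j C \<and> E \<in> p \<and> B \<in> \<A> \<and>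
        finite (B \<inter> (\<Union>n\<in>E. C n))"
      by simp
    then show ?thesis
      by blast
  qed
  then obtain p E B where p: "\<And>C. C \<in> \<G> \<Longrightarrow> free_ultrafilter_nat (p C)"
    and rk: "\<And>C. C \<in> \<G> \<Longrightarrow> rk_below (p C) = j C"
    and E: "\<And>C. C \<in> \<G> \<Longrightarrow> E C \<in> p C"
    and B: "\<And>C. C \<in> \<G> \<Longrightarrow> B C \<in> \<A>"
    and almost_disjoint: "\<And>C. C \<in> \<G> \<Longrightarrow> finite (B C \<inter> (\<Union>n\<in>E C. C n))"
    by metis
  \<comment> \<open>One ultrafilter \<open>p C\<close> serves all selectors of \<open>C\<close>, so
    an added point leads back to a type and, by injectivity of \<open>j\<close>, to a single
    \<open>C\<close>.\<close>
  define X where "X = principal_uf K ` K \<union> {uf_image K f (p C) | C f. C \<in> \<G> \<and> (\<forall>n. f n \<in> C n)}"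
  have X_cases: "x \<in> principal_uf K ` K \<or> (\<exists>C f. C \<in> \<G> \<and> (\<forall>n. f n \<in> C n) \<and> x = uf_image K f (p C))"
    if "x \<in> X" for x
    using that unfolding X_def by blast
  have X_lim: "uf_image K f (p C) \<in> X" if "C \<in> \<G>" "\<forall>n. f n \<in> C n" for C f
    using that unfolding X_def by blast
  have principal_X: "principal_uf K ` K \<subseteq> X"
    by (simp add: X_def)
  have X_beta: "X \<subseteq> beta_space K"
  proof
    fix x assume "x \<in> X"
    then consider "x \<in> principal_uf K ` K"
      | C f where "C \<in> \<G>" "\<forall>n. f n \<in> C n" "x = uf_image K f (p C)"
      using X_cases by blast
    then show "x \<in> beta_space K"
    proof cases
      case 1
      then show ?thesis
        by (auto simp: principal_in_beta)
    next
      case 2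
      then show ?thesis
        using uf_image_in_beta[OF p[OF 2(1)]] disjoint_finite_seq_selector(2)[of K C f]
        by (simp add: \<G>_def)
    qed
  qed
  interpret beta_subspace K X
    using principal_X X_beta by unfold_locales
  have "pseudocompact (vietoris T)"
  proof (rule pseudocompact_vietorisI)
    fix C assume "disjoint_finite_seq K C"
    then have "C \<in> \<G>"
      by (simp add: \<G>_def)
    then show "\<exists>p. free_ultrafilter_nat p \<and> (\<forall>f. (\<forall>n. f n \<in> C n) \<longrightarrow> uf_image K f p \<in> X)"
      using p X_lim by blast
  qed
  moreover have "\<not> theta_omega_pseudocompact Th T"
  proof
    assume theta: "theta_omega_pseudocompact Th T"
    \<comment> \<open>\<open>C0\<close> shows that \<open>\<A>\<close> is nonempty and later
      supplies a first limit, from which a sequence with the type of \<open>q\<close> is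
      found.\<close>
    obtain C0 where "disjoint_finite_seq K C0"
      by (rule infinite_disjoint_finite_seq[OF K_inf])
    then have C0: "C0 \<in> \<G>"
      by (simp add: \<G>_def)
    then have "\<A> \<noteq> {}"
      using B by blast
    then obtain h where h: "h ` Th = \<A>"
      using A_card card_of_ordLeq2[of \<A> Th] by blast
    have "\<exists>b :: nat \<Rightarrow> 'a. inj b \<and> range b = D" if "D \<in> \<A>" for D
    proof -
      have "countable D" "infinite D"
        using A_sub that by auto
      then obtain b :: "nat \<Rightarrow> 'a" where "bij_betw b UNIV D"
        by (rule countable_infiniteE')
      then show ?thesis
        by (auto simp: bij_betw_def)
    qed
    then obtain b :: "'a set \<Rightarrow> nat \<Rightarrow> 'a"
      where b: "\<And>D. D \<in> \<A> \<Longrightarrow> inj (b D)" "\<And>D. D \<in> \<A> \<Longrightarrow> range (b D) = D"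
      by metis
    have b_K: "range (b D) \<subseteq> K" if "D \<in> \<A>" for D
      using b(2)[OF that] A_sub that by auto
    \<comment> \<open>Points of \<open>K\<close> are isolated, so enumerations of members of
      \<open>\<A>\<close> become sequences of nonempty open sets.\<close>
    define V where "V \<alpha> n = {pr (b (h \<alpha>) n)}" for \<alpha> n
    have "openin T (V \<alpha> n) \<and> V \<alpha> n \<noteq> {}" if "\<alpha> \<in> Th" for \<alpha> n
    proof -
      have "h \<alpha> \<in> \<A>"
        using h that by blast
      then have "b (h \<alpha>) n \<in> K"
        using b_K by blast
      then show ?thesis
        by (simp add: V_def openin_principal)
    qed
    then obtain q where q: "free_ultrafilter_nat q" and lim: "\<forall>\<alpha>\<in>Th. \<exists>x. p_limit T q (V \<alpha>) x"
      using spec[OF theta[unfolded theta_omega_pseudocompact_def], of V] by auto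
    \<comment> \<open>The limit of an injective enumeration along the free \<open>q\<close> cannot
      be principal, so it is the limit of a selector; comparing the two injective sequences
      identifies \<open>j C\<close> with the type of \<open>q\<close>.\<close>
    have type: "\<exists>C f. C \<in> \<G> \<and> (\<forall>n. f n \<in> C n) \<and> uf_image K (b D) q = uf_image K f (p C) \<and> j C = rk_below q"
      if D: "D \<in> \<A>" for D
    proof -
      obtain \<alpha> where "\<alpha> \<in> Th" "h \<alpha> = D"
        using D h by blast
      moreover have "V \<alpha> = (\<lambda>n. {pr (b D n)})"
        using \<open>h \<alpha> = D\<close> by (simp add: V_def fun_eq_iff)
      ultimately obtain x where x: "p_limit T q (\<lambda>n. {pr (b D n)}) x"
        using lim by auto
      then have x_eq: "x = uf_image K (b D) q"
        by (rule p_limit_principal[OF q b_K[OF D]])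
      have "x \<in> X"
        using x by (simp add: p_limit_def)
      have "x \<notin> pr ` K"
      proof
        assume "x \<in> pr ` K"
        then obtain k where "k \<in> K" "uf_image K (b D) q = pr k"
          using x_eq by blast
        then have "{k} \<in> uf_image K (b D) q"
          by (simp add: principal_uf_def)
        then have "b D -` {k} \<in> q"
          by (simp add: uf_image_def)
        moreover have "finite (b D -` {k})"
          using b(1)[OF D] by (intro finite_vimageI) auto
        ultimately show False
          using free_uf_infinite[OF q] by blast
      qed
      then obtain C f where C: "C \<in> \<G>" and f: "\<forall>n. f n \<in> C n" and "x = uf_image K f (p C)"
        using X_cases[OF \<open>x \<in> X\<close>] by blast
      then have eq: "uf_image K (b D) q = uf_image K f (p C)"
        by (simp add: x_eq)
      have "inj f" "range f \<subseteq> K"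
        using disjoint_finite_seq_selector[of K C f] C f by (simp_all add: \<G>_def)
      then have "rk_below q = rk_below (p C)"
        using rk_below_eqI[OF p[OF C] q b(1)[OF D] b_K[OF D] _ _ eq] by simp
      then have "j C = rk_below q"
        using rk[OF C] by simp
      with C f eq show ?thesis
        by blast
    qed
    \<comment> \<open>First some \<open>C\<close> with the type of \<open>q\<close> is found; then
      the set \<open>B C\<close> attached to this very \<open>C\<close> is used. Its limit comes
      from some \<open>C'\<close> with the same type, so \<open>C' = C\<close>.\<close>
    obtain C where C: "C \<in> \<G>" "j C = rk_below q"
      using type[OF B[OF C0]] by blast
    obtain C' f where "C' \<in> \<G>" "j C' = rk_below q" and f: "\<forall>n. f n \<in> C' n"
      and eq: "uf_image K (b (B C)) q = uf_image K f (p C')"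
      using type[OF B[OF C(1)]] by blast
    have "C' = C"
      using inj_onD[OF j(1), of C' C] C \<open>C' \<in> \<G>\<close> \<open>j C' = rk_below q\<close> by simp
    \<comment> \<open>\<open>E C\<close> belongs to \<open>p C\<close>, so \<open>q\<close>-many
      terms of the enumeration of \<open>B C\<close> lie in \<open>\<Union>n\<in>E C. C n\<close>,
      although only finitely many points of \<open>B C\<close> do.\<close>
    have "f -` (f ` E C) \<in> p C"
      using E[OF C(1)] by (rule free_uf_mono[OF p[OF C(1)]]) auto
    moreover have "range f \<subseteq> K"
      using disjoint_finite_seq_selector(2)[of K C f] C(1) f \<open>C' = C\<close> by (simp add: \<G>_def)
    ultimately have "f ` E C \<in> uf_image K (b (B C)) q"
      unfolding eq \<open>C' = C\<close> by (auto simp: uf_image_def)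
    then have mem: "b (B C) -` (f ` E C) \<in> q"
      by (simp add: uf_image_def)
    have "f ` E C \<subseteq> (\<Union>n\<in>E C. C n)"
      using f \<open>C' = C\<close> by auto
    moreover have "b (B C) k \<in> B C" for k
      using b(2)[OF B[OF C(1)]] rangeI[of "b (B C)" k] by simp
    ultimately have "b (B C) -` (f ` E C) \<subseteq> b (B C) -` (B C \<inter> (\<Union>n\<in>E C. C n))"
      by blast
    moreover have "finite (b (B C) -` (B C \<inter> (\<Union>n\<in>E C. C n)))"
      using almost_disjoint[OF C(1)] b(1)[OF B[OF C(1)]] by (rule finite_vimageI)
    ultimately show False
      using free_uf_infinite[OF q mem] finite_subset by blast
  qed
  ultimately show ?thesis
    using principal_X X_beta unfolding T_def by blast
qed

end
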